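(* Let $\Gamma$ be a strongly connected directed graph with $n$ vertices and let $P$ be its transition probability matrix. Suppose $P$ is irreducible, aperiodic, and diagonalizable. Let $C$ be an $n\times n$ matrix whose columns are unit-length eigenvectors of $P$ forming a basis of $\mathbb{C}^n$. Let $\boldsymbol{\pi}^T$ be the unique stationary distribution of $P$, with maximal and minimal components $\pi_{max}$ and $\pi_{min}$, and let $\rho$ be the maximum of $|\lambda|$ over the eigenvalues $\lambda$ of $P$ other than the dominant eigenvalue $1$. Then $$t(\Gamma)\ \ge\ \frac{1}{3}\left(\frac{\pi_{min}}{\pi_{max}\,\rho\,\kappa(C)} - \frac{1}{1+\frac{\rho\lVert C\rVert^2\pi_{min}}{\kappa(C)\,\pi_{max}}} - 1\right),$$ where $\kappa(C)=\lVert C\rVert\,\lVert C^{-1}\rVert$.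
   Context: The transition probability matrix $P$ of a directed graph $\Gamma$ with vertices $v_1,\dots,v_n$ is the $n\times n$ matrix with $p_{ij}=1/d^-(v_i)$ if $(v_i,v_j)$ is an edge of $\Gamma$ and $p_{ij}=0$ otherwise, where $d^-(v_i)$ is the outdegree of $v_i$. When $P$ is irreducible and aperiodic its dominant eigenvalue is $1$ and it has a unique stationary distribution $\boldsymbol{\pi}^T$ (a left eigenvector for eigenvalue $1$ with positive entries summing to $1$). $\lVert\cdot\rVert$ is the operator norm induced by the Euclidean norm. A directed graph is strongly connected if there is a directed path from every vertex to every other vertex. The toughness of a directed graph is $t(\Gamma)=\min_S \frac{|S|}{c(\Gamma-S)}$, where the minimum is over subsets $S\subseteq V(\Gamma)$ whose deletion yields a graph $\Gamma-S$ with two or more strongly connected components, and $c(\Gamma-S)$ is the number of strongly connected components of $\Gamma-S$ (if no such $S$ exists, $t(\Gamma)=+\infty$ by the usual convention). *)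

theory Defs
  imports "HOL-Analysis.Analysis" "Graph_Theory.Digraph_Component"
begin

text \<open>Vertices are the elements of a finite type \<open>'n\<close>, which also indexes the rows and columns of
  the matrices.\<close>

definition transition_matrix :: "('n::finite, 'e) pre_digraph \<Rightarrow> real^'n^'n" where
  "transition_matrix G =
     (\<chi> i j. if (i, j) \<in> arcs_ends G then 1 / real (out_degree G i) else 0)"

text \<open>Powers with respect to \<open>**\<close>; the operations \<open>*\<close> and \<open>^\<close> on type \<open>vec\<close> are componentwise.\<close>

definition matpow :: "'a::semiring_1^'n^'n \<Rightarrow> nat \<Rightarrow> 'a^'n^'n" where
  "matpow A k = (((**) A) ^^ k) (mat 1)"

definition irreducible_matrix :: "real^'n^'n \<Rightarrow> bool" where
  "irreducible_matrix P \<longleftrightarrow> (\<forall>i j. \<exists>k. matpow P k $ i $ j > 0)"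

definition aperiodic_matrix :: "real^'n^'n \<Rightarrow> bool" where
  "aperiodic_matrix P \<longleftrightarrow> (\<forall>i. Gcd {k::nat. k > 0 \<and> matpow P k $ i $ i > 0} = 1)"

definition eigenvector_of :: "complex^'n^'n \<Rightarrow> complex^'n \<Rightarrow> complex \<Rightarrow> bool" where
  "eigenvector_of A v \<mu> \<longleftrightarrow> v \<noteq> 0 \<and> A *v v = \<mu> *s v"

definition eigenvalue_of :: "complex^'n^'n \<Rightarrow> complex \<Rightarrow> bool" where
  "eigenvalue_of A \<mu> \<longleftrightarrow> (\<exists>v. eigenvector_of A v \<mu>)"

definition diagonalizable_matrix :: "complex^'n^'n \<Rightarrow> bool" where
  "diagonalizable_matrix A \<longleftrightarrow>
     (\<exists>(S::complex^'n^'n) (D::complex^'n^'n). invertible S \<and>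
       (\<forall>i j. i \<noteq> j \<longrightarrow> D $ i $ j = 0) \<and> A = S ** D ** matrix_inv S)"

definition stationary_distribution :: "real^'n^'n \<Rightarrow> real^'n \<Rightarrow> bool" where
  "stationary_distribution P p \<longleftrightarrow>
     p v* P = p \<and> (\<forall>i. p $ i > 0) \<and> (\<Sum>i\<in>UNIV. p $ i) = 1"

text \<open>The norm of \<open>complex^'n\<close> is the Euclidean one, so this is the induced spectral norm.\<close>

definition opnorm :: "complex^'n^'n \<Rightarrow> real" where
  "opnorm A = onorm ((*v) A)"

definition cond_number :: "complex^'n^'n \<Rightarrow> real" where
  "cond_number A = opnorm A * opnorm (matrix_inv A)"

text \<open>For a finite digraph the infimum ranges over finitely many sets, so it is a minimum unless
  there is no separating set, in which case it is \<open>\<infinity>\<close>.\<close>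

definition toughness :: "('a, 'b) pre_digraph \<Rightarrow> ereal" where
  "toughness G =
     (INF S \<in> {S. S \<subseteq> verts G \<and> card (pre_digraph.sccs (G \<restriction> (verts G - S))) \<ge> 2}.
        ereal (real (card S) / real (card (pre_digraph.sccs (G \<restriction> (verts G - S))))))"

end

theory Submission
  imports Defs
begin

text \<open>
  Put \<open>\<sigma> = \<rho> \<kappa>(C) \<pi>\<^sub>m\<^sub>a\<^sub>x / \<pi>\<^sub>m\<^sub>i\<^sub>n\<close>. Diagonalising \<open>P\<close> by \<open>C\<close> shows that \<open>P\<close> minus the
  rank-one matrix \<open>1 \<pi>\<^sup>T\<close> has norm at most \<open>\<rho> \<kappa>(C)\<close>. This gives a mixing lemma: if no arc leads
  from \<open>X\<close> to \<open>Y\<close>, then \<open>|X| |Y| \<le> \<sigma>\<^sup>2 (n - |X|) (n - |Y|)\<close>. If deleting \<open>S\<close> leaves \<open>c \<ge> 2\<close> strong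
  components, cutting a topological ordering of them in the middle yields such \<open>X\<close> and \<open>Y\<close>, which
  partition the complement of \<open>S\<close> and have at least \<open>c / 3\<close> vertices each. With \<open>t = |S| / c\<close> the
  mixing lemma then gives \<open>1 - \<sigma>\<^sup>2 \<le> 6 \<sigma>\<^sup>2 t (1 + t)\<close>, which forces
  \<open>3 t \<ge> 1 / \<sigma> - 1 / (1 + \<sigma>) - 1\<close>. The claimed bound is weaker since \<open>\<parallel>C\<^sup>-\<^sup>1\<parallel> \<ge> 1\<close>.
\<close>

subsection \<open>One-way cuts between strong components\<close>

text \<open>An initial segment of prescribed size, built by repeatedly moving a minimiser of
  \<open>f\<close> out of the remainder. Ties may be cut anywhere, so the comparison is only
  weak.\<close>

lemma ex_lower_subset_of_card:
  fixes f :: "'a \<Rightarrow> 'b::linorder"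
  assumes "finite A" and "k \<le> card A"
  shows "\<exists>B\<subseteq>A. card B = k \<and> (\<forall>b\<in>B. \<forall>a\<in>A - B. f b \<le> f a)"
  using assms(2)
proof (induction k)
  case 0
  show ?case by (rule exI[of _ "{}"]) simp
next
  case (Suc k)
  then obtain B where B: "B \<subseteq> A" "card B = k" "\<forall>b\<in>B. \<forall>a\<in>A - B. f b \<le> f a"
    by auto
  have finB: "finite B" using B(1) assms(1) finite_subset by blast
  have "A - B \<noteq> {}"
  proof
    assume "A - B = {}"
    then have "A = B" using B(1) by blast
    then show False using B(2) Suc.prems by simp
  qed
  then obtain x where x: "x \<in> A - B" "\<forall>a\<in>A - B. f x \<le> f a"
    using arg_min_if_finite[of "A - B" f] assms(1) by (meson finite_Diff linorder_not_less)
  show ?case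
    by (rule exI[of _ "insert x B"]) (use B x finB in auto)
qed

text \<open>Each nonempty block contributes at least one point of its own. This converts counts of
  strong components into counts of vertices.\<close>

lemma card_le_card_Union_disjoint:
  assumes "finite (\<Union>B)" and "pairwise disjnt B" and "{} \<notin> B"
  shows "card B \<le> card (\<Union>B)"
proof -
  have fin: "finite C" if "C \<in> B" for C
    using assms(1) that by (meson Union_upper finite_subset)
  have "card B = (\<Sum>C\<in>B. 1)" by simp
  also have "\<dots> \<le> (\<Sum>C\<in>B. card C)"
  proof (rule sum_mono)
    fix C assume "C \<in> B"
    then have "C \<noteq> {}" "finite C" using assms(3) fin by auto
    then show "1 \<le> card C" by (simp add: Suc_le_eq card_gt_0_iff)
  qed
  also have "\<dots> = card (\<Union>B)"
    using card_Union_disjoint[OF assms(2) fin] by simp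
  finally show ?thesis .
qed

lemma (in wf_digraph) Union_sccs_verts: "\<Union>sccs_verts = verts G"
  using sccs_verts_subsets scc_of_in_sccs_verts in_scc_of_self by blast

lemma (in wf_digraph) disjoint_sccs_verts: "disjoint sccs_verts"
  using sccs_verts_disjoint by (auto simp: pairwise_def disjnt_def)

text \<open>Sorting the strong components by the number of vertices reachable from them orders them
  topologically, so cutting the sorted list in the middle leaves no arc from the first half to
  the second.\<close>

lemma (in fin_digraph) ex_one_way_bipartition:
  shows "\<exists>X Y. X \<union> Y = verts G \<and> X \<inter> Y = {} \<and> card sccs div 2 \<le> card X
    \<and> card sccs div 2 \<le> card Y \<and> (\<forall>u\<in>X. \<forall>v\<in>Y. (u, v) \<notin> arcs_ends G)"
proof -
  define reach where "reach u = {v. u \<rightarrow>\<^sup>*\<^bsub>G\<^esub> v}" for u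
  have fin_reach: "finite (reach u)" for u
    unfolding reach_def
    by (rule finite_subset[OF _ finite_verts]) (auto dest: reachable_in_verts)
  define f where "f K = card (\<Union>(reach ` K))" for K
  \<comment> \<open>All vertices of a strong component reach the same set, so \<open>f\<close> can
    be read off from any representative.\<close>
  have f_eq: "f K = card (reach u)" if "K \<in> sccs_verts" "u \<in> K" for K u
  proof -
    have "\<Union>(reach ` K) = reach u"
      using that unfolding in_sccs_verts_conv_reachable reach_def by (auto intro: reachable_trans)
    then show ?thesis by (simp add: f_def)
  qed
  obtain B where B: "B \<subseteq> sccs_verts" "card B = card sccs div 2"
      "\<forall>b\<in>B. \<forall>a\<in>sccs_verts - B. f b \<le> f a"
    using ex_lower_subset_of_card[OF finite_sccs_verts, of "card sccs div 2" f]
    by (auto simp: card_sccs_verts)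
  have nonempty: "{} \<notin> sccs_verts" by (simp add: in_sccs_verts_conv_reachable)
  have fin: "finite (\<Union>D)" if "D \<subseteq> sccs_verts" for D
    by (rule finite_subset[OF Union_mono[OF that, unfolded Union_sccs_verts] finite_verts])
  have le: "card D \<le> card (\<Union>D)" if "D \<subseteq> sccs_verts" for D
    by (rule card_le_card_Union_disjoint[OF fin[OF that]])
      (use that nonempty in \<open>auto intro: pairwise_subset[OF disjoint_sccs_verts]\<close>)
  have "card (sccs_verts - B) = card sccs - card sccs div 2"
    using B by (simp add: card_Diff_subset finite_subset[OF _ finite_sccs_verts] card_sccs_verts)
  then have half: "card sccs div 2 \<le> card (sccs_verts - B)" by simp
  have "(u, v) \<notin> arcs_ends G" if "u \<in> \<Union>B" "v \<in> \<Union>(sccs_verts - B)" for u v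
  proof
    assume arc: "(u, v) \<in> arcs_ends G"
    from that(1) obtain K where K: "u \<in> K" "K \<in> B" by (rule UnionE)
    from that(2) obtain L where L: "v \<in> L" "L \<in> sccs_verts" "L \<notin> B" by auto
    have K': "K \<in> sccs_verts" using K(2) B(1) by (rule rev_subsetD)
    have uv: "u \<rightarrow>\<^sup>*\<^bsub>G\<^esub> v" using arc by (rule reachable_adjI)
    then have sub: "reach v \<subseteq> reach u" unfolding reach_def by (auto intro: reachable_trans)
    \<comment> \<open>The arc gives \<open>reach v \<subseteq> reach u\<close>, while the cut gives
      the opposite inequality of cardinalities. Equality of the two sets puts \<open>u\<close> and
      \<open>v\<close> in one component, although the cut separates them.\<close>
    have "f K \<le> f L" using B(3) K(2) L(2,3) by simp
    then have "card (reach u) \<le> card (reach v)"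
      by (simp add: f_eq[OF K' K(1)] f_eq[OF L(2,1)])
    then have "reach v = reach u" using sub fin_reach by (meson card_seteq)
    moreover have "u \<in> reach u" using uv by (auto simp: reach_def dest: reachable_in_verts)
    ultimately have "v \<rightarrow>\<^sup>*\<^bsub>G\<^esub> u" by (auto simp: reach_def)
    then have "v \<in> K" using K' K(1) uv unfolding in_sccs_verts_conv_reachable by blast
    then have "K = L" using sccs_verts_disjoint[OF K' L(2)] L(1) by blast
    then show False using K L by blast
  qed
  moreover have "\<Union>B \<inter> \<Union>(sccs_verts - B) = {}"
    using B(1) by (auto dest: sccs_verts_disjoint)
  moreover have "\<Union>B \<union> \<Union>(sccs_verts - B) = verts G"
    using B(1) Union_sccs_verts by blast
  ultimately show ?thesis
    using le[OF B(1)] le[of "sccs_verts - B"] B(2) half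
    by (intro exI[of _ "\<Union>B"] exI[of _ "\<Union>(sccs_verts - B)"]) auto
qed

lemma (in fin_digraph) card_sccs_le_card_verts: "card sccs \<le> card (verts G)"
proof -
  have "card sccs_verts \<le> card (\<Union>sccs_verts)"
    by (rule card_le_card_Union_disjoint)
      (auto simp: Union_sccs_verts disjoint_sccs_verts in_sccs_verts_conv_reachable)
  then show ?thesis by (simp add: Union_sccs_verts card_sccs_verts)
qed

section \<open>Stochasticity of the transition matrix\<close>

text \<open>Without parallel arcs \<open>head G\<close> is injective on the arcs leaving
  \<open>i\<close>, so the out-degree counts the nonzero entries of row \<open>i\<close>.\<close>

lemma row_sum_transition_matrix:
  fixes G :: "('n::finite, 'e) pre_digraph"
  assumes "nomulti_digraph G" and "out_degree G i > 0"
  shows "(\<Sum>j\<in>UNIV. transition_matrix G $ i $ j) = 1"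
proof -
  have "bij_betw (head G) (out_arcs G i) {j. (i, j) \<in> arcs_ends G}"
    unfolding bij_betw_def
  proof
    show "inj_on (head G) (out_arcs G i)"
      by (rule inj_onI, rule nomulti_digraph.no_multi_arcs[OF assms(1)])
        (auto simp: arc_to_ends_def)
    show "head G ` out_arcs G i = {j. (i, j) \<in> arcs_ends G}"
      by (auto simp: arcs_ends_def arc_to_ends_def)
  qed
  then have "card {j. (i, j) \<in> arcs_ends G} = out_degree G i"
    by (simp add: bij_betw_same_card out_degree_def)
  then show ?thesis
    using assms(2)
    by (simp add: transition_matrix_def sum.If_cases)
qed

text \<open>A path to a different vertex has a first arc. This excludes zero rows of the transition
  matrix.\<close>

lemma (in fin_digraph) out_degree_pos_if_strongly_connected:
  assumes "strongly_connected G" and "i \<in> verts G" and "j \<in> verts G" and "i \<noteq> j"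
  shows "out_degree G i > 0"
proof -
  have "i \<rightarrow>\<^sup>*\<^bsub>G\<^esub> j" using assms by (simp add: strongly_connected_def)
  then obtain k where "(i, k) \<in> arcs_ends G"
    using assms(4) by (auto elim: converse_reachable_cases)
  then have "out_arcs G i \<noteq> {}" by (auto simp: arcs_ends_def arc_to_ends_def)
  then show ?thesis by (simp add: out_degree_def card_gt_0_iff finite_out_arcs)
qed

subsection \<open>Mixing for Markov chains\<close>

lemma matrix_inv_mult:
  assumes "invertible (A :: 'a::semiring_1^'n^'m)"
  shows "A ** matrix_inv A = mat 1" and "matrix_inv A ** A = mat 1"
proof -
  have "\<exists>A'. A ** A' = mat 1 \<and> A' ** A = mat 1" using assms by (simp add: invertible_def)
  then have "A ** matrix_inv A = mat 1 \<and> matrix_inv A ** A = mat 1"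
    unfolding matrix_inv_def by (rule someI_ex)
  then show "A ** matrix_inv A = mat 1" and "matrix_inv A ** A = mat 1" by auto
qed

lemma norm_matrix_vector_mult_le_opnorm: "norm (A *v x) \<le> opnorm A * norm x"
  unfolding opnorm_def by (rule onorm) simp

lemma matrix_vector_mult_axis: "A *v axis j 1 = column j A" for A :: "'a::semiring_1^'n^'m"
  by (simp add: vec_eq_iff matrix_vector_mult_def column_def axis_def if_distrib cong: if_cong)

lemma norm_column_le_opnorm: "norm (column j A) \<le> opnorm A"
  using norm_matrix_vector_mult_le_opnorm[of A "axis j 1"]
  by (simp add: matrix_vector_mult_axis norm_axis_1)

text \<open>The inverse sends a unit column of \<open>C\<close> to a unit basis vector. Consequently
  \<open>opnorm C\<close> is at most \<open>cond_number C\<close>.\<close>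

lemma one_le_opnorm_matrix_inv:
  assumes "invertible C" and "norm (column j C) = 1"
  shows "1 \<le> opnorm (matrix_inv C)"
proof -
  have "matrix_inv C *v column j C = axis j 1"
    by (metis matrix_vector_mult_axis matrix_inv_mult(2)[OF assms(1)] matrix_vector_mul_assoc
        matrix_vector_mul_lid)
  then have "norm (axis j 1 :: complex^'a) \<le> opnorm (matrix_inv C) * norm (column j C)"
    by (metis norm_matrix_vector_mult_le_opnorm)
  then show ?thesis by (simp add: assms(2) norm_axis_1)
qed

text \<open>The Dirichlet form of a harmonic function vanishes.\<close>

lemma harmonic_eq_on_arcs:
  fixes P :: "real^'n^'n"
  assumes "\<And>i j. P $ i $ j \<ge> 0" and rows: "\<And>i. (\<Sum>j\<in>UNIV. P $ i $ j) = 1"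
    and "stationary_distribution P p" and harm: "P *v f = f" and "P $ i $ j > 0"
  shows "f $ i = f $ j"
proof -
  have p: "p v* P = p" "\<And>i. p $ i > 0" using assms(3) by (auto simp: stationary_distribution_def)
  have stat: "(\<Sum>i\<in>UNIV. p $ i * P $ i $ j) = p $ j" for j
    using arg_cong[OF p(1), of "\<lambda>v. v $ j"] by (simp add: vector_matrix_mult_def mult.commute)
  have Pf: "(\<Sum>j\<in>UNIV. P $ i $ j * f $ j) = f $ i" for i
    using arg_cong[OF harm, of "\<lambda>v. v $ i"] by (simp add: matrix_vector_mult_def)
  let ?E = "\<lambda>i j. p $ i * P $ i $ j * (f $ i - f $ j)\<^sup>2"
  have nn: "?E i j \<ge> 0" for i j using assms(1) p(2) by (simp add: less_imp_le)
  \<comment> \<open>After expanding the square, the row sums, harmonicity and stationarity turn the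
    three terms into the same weighted sum of squares of \<open>f\<close>, with coefficients 1, -2
    and 1.\<close>
  have "(\<Sum>i\<in>UNIV. \<Sum>j\<in>UNIV. ?E i j)
      = (\<Sum>i\<in>UNIV. p $ i * (f $ i)\<^sup>2 * (\<Sum>j\<in>UNIV. P $ i $ j))
        - 2 * (\<Sum>i\<in>UNIV. p $ i * f $ i * (\<Sum>j\<in>UNIV. P $ i $ j * f $ j))
        + (\<Sum>i\<in>UNIV. \<Sum>j\<in>UNIV. p $ i * P $ i $ j * (f $ j)\<^sup>2)"
    by (simp add: sum_distrib_left sum_subtractf[symmetric] sum.distrib[symmetric]
        power2_eq_square algebra_simps)
  also have "(\<Sum>i\<in>UNIV. \<Sum>j\<in>UNIV. p $ i * P $ i $ j * (f $ j)\<^sup>2)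
      = (\<Sum>j\<in>UNIV. (\<Sum>i\<in>UNIV. p $ i * P $ i $ j) * (f $ j)\<^sup>2)"
    by (subst sum.swap) (simp add: sum_distrib_right)
  finally have "(\<Sum>i\<in>UNIV. \<Sum>j\<in>UNIV. ?E i j) = 0"
    by (simp add: rows Pf stat power2_eq_square mult.assoc sum_distrib_left)
  then have "(\<Sum>j\<in>UNIV. ?E i j) = 0"
    by (subst (asm) sum_nonneg_eq_0_iff) (auto intro: sum_nonneg nn)
  then have "?E i j = 0"
    by (subst (asm) sum_nonneg_eq_0_iff) (auto intro: nn)
  then show ?thesis using p(2)[of i] assms(5) by simp
qed

text \<open>
  The deflated matrix is tested against \<open>h = 1\<^sub>Y - |Y| / n\<close> on the right and, on the left, against the
  vector \<open>g\<close> that is a constant \<open>\<alpha>\<close> on \<open>X\<close> and \<open>- p\<close> off \<open>X\<close>; up to a multiple of \<open>p\<close>, which the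
  deflated matrix annihilates, \<open>g\<close> is supported on \<open>X\<close>. The value of \<open>\<alpha>\<close> is the optimal one when
  \<open>p = M\<close> off \<open>X\<close>.
\<close>

lemma one_way_mixing:
  fixes P :: "real^'n^'n"
  assumes rows: "\<And>i. (\<Sum>j\<in>UNIV. P $ i $ j) = 1"
    and "stationary_distribution P p"
    and pmin: "\<And>i. m \<le> p $ i" "0 < m" and pmax: "\<And>i. p $ i \<le> M"
    and K: "0 \<le> K" "\<And>f. norm (P *v f - (p \<bullet> f) *s 1) \<le> K * norm f"
    and "X \<noteq> {}" and "Y \<noteq> {}" and noarc: "\<And>i j. i \<in> X \<Longrightarrow> j \<in> Y \<Longrightarrow> P $ i $ j = 0"
  shows "m\<^sup>2 * (real (card X) * real (card Y))
    \<le> (K * M)\<^sup>2 * (real (card (- X)) * real (card (- Y)))"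
proof -
  have p: "p v* P = p" "\<And>i. p $ i > 0" "(\<Sum>i\<in>UNIV. p $ i) = 1"
    using assms(2) by (auto simp: stationary_distribution_def)
  have stat: "(\<Sum>i\<in>UNIV. p $ i * P $ i $ j) = p $ j" for j
    using arg_cong[OF p(1), of "\<lambda>v. v $ j"] by (simp add: vector_matrix_mult_def mult.commute)
  define A where "A = real (card X)"
  define B where "B = real (card (- X))"
  define D where "D = real (card Y)"
  define E where "E = real (card (- Y))"
  define pX where "pX = (\<Sum>i\<in>X. p $ i)"
  define pY where "pY = (\<Sum>i\<in>Y. p $ i)"
  define n where "n = real CARD('n)"
  have "card X + card (- X) = CARD('n)" "card Y + card (- Y) = CARD('n)"
    by (simp_all add: Compl_eq_Diff_UNIV card_Diff_subset card_mono)
  then have n: "n = A + B" "n = D + E" unfolding A_def B_def D_def E_def n_def by linarith+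
  have pos: "A > 0" "D > 0" "B \<ge> 0" "E \<ge> 0" "n > 0"
    using assms(8,9) by (auto simp: A_def B_def D_def E_def n_def card_gt_0_iff)
  have "M > 0" using pmin pmax by (meson less_le_trans)
  have pX: "pX > 0" unfolding pX_def by (rule sum_pos) (use assms(8) p(2) in auto)
  have pY: "m * D \<le> pY"
    using sum_mono[of Y "\<lambda>_. m" "\<lambda>i. p $ i"] pmin(1) by (simp add: pY_def D_def mult.commute)
  have "(\<Sum>i\<in>UNIV. p $ i) = pX + (\<Sum>i\<in>-X. p $ i)"
    unfolding pX_def by (subst sum.union_disjoint[symmetric]) auto
  also have "(\<Sum>i\<in>-X. p $ i) \<le> M * B"
    using sum_mono[of "-X" "\<lambda>i. p $ i" "\<lambda>_. M"] pmax by (simp add: B_def mult.commute)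
  finally have cover: "1 \<le> pX + M * B" by (simp add: p(3))

  define \<alpha> where "\<alpha> = M\<^sup>2 * B / pX"
  define F where "F = \<alpha> * A + pX"
  have "\<alpha> \<ge> 0" using pos pX by (simp add: \<alpha>_def)
  have "F > 0" using \<open>\<alpha> \<ge> 0\<close> pos pX by (simp add: F_def add_nonneg_pos)
  define g :: "real^'n" where "g = (\<chi> i. if i \<in> X then \<alpha> else - p $ i)"
  define h :: "real^'n" where "h = (\<chi> i. (if i \<in> Y then 1 else 0) - D / n)"
  have split: "(\<Sum>i\<in>UNIV. w i) = (\<Sum>i\<in>Z. w i) + (\<Sum>i\<in>-Z. w i)" for Z and w :: "'n \<Rightarrow> real"
    by (subst sum.union_disjoint[symmetric]) auto
  have "(norm g)\<^sup>2 = (\<Sum>i\<in>UNIV. (g $ i)\<^sup>2)"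
    by (simp add: norm_eq_sqrt_inner inner_vec_def sum_nonneg power2_eq_square)
  also have "\<dots> = A * \<alpha>\<^sup>2 + (\<Sum>i\<in>-X. (p $ i)\<^sup>2)"
    unfolding split[of _ X] by (simp add: g_def A_def)
  also have "(\<Sum>i\<in>-X. (p $ i)\<^sup>2) \<le> (\<Sum>i\<in>-X. M\<^sup>2)"
    using p(2) pmax by (intro sum_mono power_mono) (auto intro: less_imp_le)
  \<comment> \<open>By the choice of \<open>\<alpha>\<close>, the off-\<open>X\<close> contribution
    \<open>M\<^sup>2 * B\<close> equals \<open>\<alpha> * pX\<close>, so the factor
    \<open>\<alpha>\<close> comes out.\<close>
  also have "A * \<alpha>\<^sup>2 + (\<Sum>i\<in>-X. M\<^sup>2) = \<alpha> * F"
    using pX by (simp add: F_def \<alpha>_def B_def field_simps power2_eq_square)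
  finally have g: "(norm g)\<^sup>2 \<le> \<alpha> * F" by simp
  have "(norm h)\<^sup>2 = (\<Sum>i\<in>UNIV. (h $ i)\<^sup>2)"
    by (simp add: norm_eq_sqrt_inner inner_vec_def sum_nonneg power2_eq_square)
  also have "\<dots> = D * (1 - D / n)\<^sup>2 + E * (D / n)\<^sup>2"
    unfolding split[of _ Y] by (simp add: h_def D_def E_def)
  also have "\<dots> = D * E / n"
  proof -
    have "1 - D / n = E / n" using n pos by (simp add: field_simps)
    then have "D * (1 - D / n)\<^sup>2 + E * (D / n)\<^sup>2 = D * (E / n)\<^sup>2 + E * (D / n)\<^sup>2"
      by simp
    also have "\<dots> = D * E * (D + E) / n\<^sup>2"
      by (simp add: power_divide power2_eq_square algebra_simps flip: add_divide_distrib)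
    also have "\<dots> = D * E / n" using n(2) pos(5) by (simp add: power2_eq_square)
    finally show ?thesis .
  qed
  finally have h: "(norm h)\<^sup>2 = D * E / n" .

  let ?Mh = "P *v h - (p \<bullet> h) *s 1"
  \<comment> \<open>The constant shift in \<open>h\<close> cancels because the rows of
    \<open>P\<close> and the vector \<open>p\<close> all sum to 1.\<close>
  have Mh: "?Mh $ i = (\<Sum>j\<in>Y. P $ i $ j) - pY" for i
  proof -
    have h_sum: "(\<Sum>j\<in>UNIV. w j * h $ j) = (\<Sum>j\<in>Y. w j) - (\<Sum>j\<in>UNIV. w j) * (D / n)" for w
    proof -
      have "(\<Sum>j\<in>UNIV. w j * h $ j) = (\<Sum>j\<in>UNIV. (if j \<in> Y then w j else 0) - w j * (D / n))"
        by (rule sum.cong) (auto simp: h_def algebra_simps)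
      then show ?thesis by (simp only: sum_subtractf sum_distrib_right) (simp add: sum.If_cases)
    qed
    have "(P *v h) $ i = (\<Sum>j\<in>Y. P $ i $ j) - D / n"
      by (simp add: matrix_vector_mult_def h_sum rows)
    moreover have "p \<bullet> h = pY - D / n"
      by (simp add: inner_vec_def h_sum p(3) pY_def)
    ultimately show ?thesis by simp
  qed
  \<comment> \<open>Here \<open>g\<close> is \<open>\<alpha> + p\<close> restricted to
    \<open>X\<close>, minus \<open>p\<close>. On \<open>X\<close> the vector \<open>?Mh\<close> is
    constantly \<open>- pY\<close> by \<open>noarc\<close>, and the weights
    \<open>\<alpha> + p\<close> sum to \<open>F\<close> there.\<close>
  have "g \<bullet> ?Mh = (\<Sum>i\<in>UNIV. (if i \<in> X then \<alpha> + p $ i else 0) * ?Mh $ i)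
      - (\<Sum>i\<in>UNIV. p $ i * ?Mh $ i)"
    unfolding inner_vec_def sum_subtractf[symmetric]
    by (rule sum.cong) (auto simp: g_def algebra_simps)
  also have "(\<Sum>i\<in>UNIV. (if i \<in> X then \<alpha> + p $ i else 0) * ?Mh $ i) = (\<Sum>i\<in>X. (\<alpha> + p $ i) * (- pY))"
    unfolding Mh split[of _ X] by (simp add: noarc)
  also have "\<dots> = - (F * pY)"
    unfolding sum_distrib_right[symmetric] by (simp add: F_def A_def pX_def sum.distrib mult.commute)
  also have "(\<Sum>i\<in>UNIV. p $ i * ?Mh $ i) = 0"
  proof -
    have "(\<Sum>i\<in>UNIV. p $ i * ?Mh $ i)
        = (\<Sum>j\<in>Y. \<Sum>i\<in>UNIV. p $ i * P $ i $ j) - (\<Sum>i\<in>UNIV. p $ i) * pY"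
      unfolding Mh by (subst sum.swap)
        (simp add: right_diff_distrib sum_subtractf sum_distrib_left sum_distrib_right)
    then show ?thesis by (simp add: stat p(3) pY_def)
  qed
  finally have "F * pY = - (g \<bullet> ?Mh)" by simp
  also have "\<dots> \<le> norm g * norm ?Mh"
    using Cauchy_Schwarz_ineq2[of g ?Mh] by linarith
  also have "\<dots> \<le> norm g * (K * norm h)" by (intro mult_left_mono K(2)) simp
  finally have "F * pY \<le> norm g * (K * norm h)" .
  moreover have "0 \<le> F * pY" using \<open>F > 0\<close> pY pmin(2) pos by (meson less_imp_le mult_nonneg_nonneg order_trans)
  ultimately have "(F * pY)\<^sup>2 \<le> (norm g * (K * norm h))\<^sup>2" by (rule power_mono)
  also have "\<dots> = (norm g)\<^sup>2 * (K\<^sup>2 * (D * E / n))" by (simp add: power_mult_distrib h)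
  also have "\<dots> \<le> \<alpha> * F * (K\<^sup>2 * (D * E / n))"
    using g pos by (intro mult_right_mono) auto
  finally have "F * (F * pY\<^sup>2) \<le> F * (\<alpha> * (K\<^sup>2 * (D * E / n)))"
    by (simp add: power2_eq_square mult_ac)
  then have "F * pY\<^sup>2 \<le> \<alpha> * (K\<^sup>2 * (D * E / n))"
    using \<open>F > 0\<close> by (simp only: mult_le_cancel_left_pos)
  moreover have "(m * D)\<^sup>2 \<le> pY\<^sup>2" using pY pmin(2) pos by (intro power_mono) auto
  ultimately have "F * (m * D)\<^sup>2 \<le> \<alpha> * (K\<^sup>2 * (D * E / n))"
    using \<open>F > 0\<close> by (meson less_imp_le mult_left_mono order_trans)
  then have "(F * pX * n) * m\<^sup>2 * D \<le> (\<alpha> * pX) * K\<^sup>2 * E"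
    using pX pos by (simp add: power2_eq_square field_simps)
  also have "(\<alpha> * pX) * K\<^sup>2 * E = (K * M)\<^sup>2 * (B * E)"
    using pX by (simp add: \<alpha>_def power_mult_distrib)
  finally have upper: "(F * pX * n) * (m\<^sup>2 * D) \<le> (K * M)\<^sup>2 * (B * E)" by simp
  \<comment> \<open>Lagrange's identity: \<open>F * pX * n = A * (pX + M * B)\<^sup>2 + B * (M * A -
    pX)\<^sup>2\<close>. The last square is dropped, and \<open>cover\<close> bounds the first one
    below by 1.\<close>
  have "A \<le> A * (pX + M * B)\<^sup>2"
    using cover pos by (simp add: mult_le_cancel_left1)
  also have "\<dots> = F * pX * n - B * (M * A - pX)\<^sup>2"
    using pX by (simp add: F_def \<alpha>_def n(1) field_simps power2_eq_square)
  also have "\<dots> \<le> F * pX * n" using pos by simp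
  finally have "A * (m\<^sup>2 * D) \<le> (F * pX * n) * (m\<^sup>2 * D)"
    using pos by (intro mult_right_mono) auto
  with upper have "A * (m\<^sup>2 * D) \<le> (K * M)\<^sup>2 * (B * E)" by linarith
  then show ?thesis by (simp add: A_def B_def D_def E_def algebra_simps)
qed

subsection \<open>The norm of the deflated transition matrix\<close>

definition diag_matrix :: "('n \<Rightarrow> 'a) \<Rightarrow> 'a::zero^'n^'n" where
  "diag_matrix d = (\<chi> i j. if i = j then d i else 0)"

lemma diag_matrix_mult_vec [simp]: "(diag_matrix d *v x) $ i = d i * x $ i"
  for d :: "'n::finite \<Rightarrow> 'a::semiring_1"
  by (simp add: diag_matrix_def matrix_vector_mult_def if_distrib[of "\<lambda>a. a * _"] cong: if_cong)

lemma norm_diag_matrix_mult_vec_le: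
  fixes x :: "complex^'n"
  assumes "0 \<le> r" and "\<And>i. cmod (d i) \<le> r"
  shows "norm (diag_matrix d *v x) \<le> r * norm x"
proof -
  have "norm (diag_matrix d *v x) \<le> norm (r *\<^sub>R x)"
    by (rule norm_le_componentwise_cart) (use assms in \<open>simp add: norm_mult mult_right_mono\<close>)
  then show ?thesis using assms(1) by simp
qed

lemma matrix_mult_eq_mult_diag_matrix_iff:
  fixes A C :: "'a::comm_semiring_1^'n^'n"
  shows "A ** C = C ** diag_matrix d \<longleftrightarrow> (\<forall>j. A *v column j C = d j *s column j C)"
proof -
  have "(A ** C) $ i $ j = (A *v column j C) $ i" for i j
    by (simp add: matrix_matrix_mult_def matrix_vector_mult_def column_def)
  moreover have "(C ** diag_matrix d) $ i $ j = (d j *s column j C) $ i" for i j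
    by (simp add: matrix_matrix_mult_def diag_matrix_def column_def if_distrib[of "\<lambda>a. _ * a"]
        mult.commute cong: if_cong)
  ultimately show ?thesis by (simp add: vec_eq_iff) blast
qed

text \<open>In the coordinates given by \<open>C\<close> the matrix is diagonal, and any nonzero
  coordinate of an eigenvector identifies its eigenvalue. Hence there are only finitely many
  eigenvalues, as needed for the maximum defining \<open>\<rho>\<close>.\<close>

lemma eigenvalue_of_diagonalized:
  fixes A C :: "complex^'n^'n"
  assumes "invertible C" and eig: "\<And>j. A *v column j C = \<mu> j *s column j C"
    and "eigenvalue_of A l"
  shows "l \<in> range \<mu>"
proof -
  obtain v where v: "v \<noteq> 0" "A *v v = l *s v"
    using assms(3) by (auto simp: eigenvalue_of_def eigenvector_of_def)
  define y where "y = matrix_inv C *v v"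
  have Cy: "C *v y = v"
    by (simp add: y_def matrix_vector_mul_assoc matrix_inv_mult[OF assms(1)])
  have "y \<noteq> 0" using v(1) Cy by auto
  then obtain j where j: "y $ j \<noteq> 0" by (auto simp: vec_eq_iff)
  have AC: "A ** C = C ** diag_matrix \<mu>"
    using eig by (simp add: matrix_mult_eq_mult_diag_matrix_iff)
  have "C *v (diag_matrix \<mu> *v y) = C *v (l *s y)"
    by (metis AC Cy v(2) matrix_vector_mul_assoc vector_scalar_commute)
  then have "matrix_inv C *v (C *v (diag_matrix \<mu> *v y)) = matrix_inv C *v (C *v (l *s y))"
    by simp
  then have "diag_matrix \<mu> *v y = l *s y"
    unfolding matrix_vector_mul_assoc[of "matrix_inv C" C] by (simp add: matrix_inv_mult[OF assms(1)])
  then have "(diag_matrix \<mu> *v y) $ j = (l *s y) $ j" by simp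
  then have "\<mu> j = l" using j by simp
  then show ?thesis by blast
qed

text \<open>Every eigenvector for an eigenvalue other than 1 is annihilated by the stationary
  distribution, so subtracting the rank-one matrix with all rows equal to it only replaces the
  eigenvalue 1 by 0.\<close>

lemma norm_deflation_le:
  fixes P :: "real^'n^'n"
  assumes rows: "\<And>i. (\<Sum>j\<in>UNIV. P $ i $ j) = 1" and "stationary_distribution P p"
    and const: "\<And>f i j. P *v f = f \<Longrightarrow> f $ i = f $ j"
    and inv: "invertible C"
    and eig: "\<And>j. map_matrix complex_of_real P *v column j C = \<mu> j *s column j C"
    and r: "0 \<le> r" "\<And>j. \<mu> j \<noteq> 1 \<Longrightarrow> cmod (\<mu> j) \<le> r"
  shows "norm (P *v f - (p \<bullet> f) *s 1) \<le> r * cond_number C * norm f"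
proof -
  have p: "p v* P = p" "(\<Sum>i\<in>UNIV. p $ i) = 1"
    using assms(2) by (auto simp: stationary_distribution_def)
  have stat: "(\<Sum>i\<in>UNIV. p $ i * P $ i $ j) = p $ j" for j
    using arg_cong[OF p(1), of "\<lambda>v. v $ j"] by (simp add: vector_matrix_mult_def mult.commute)
  define Q :: "complex^'n^'n" where "Q = (\<chi> i j. of_real (P $ i $ j - p $ j))"
  have Qv: "(Q *v x) $ i = (map_matrix complex_of_real P *v x) $ i - (\<Sum>j\<in>UNIV. of_real (p $ j) * x $ j)"
    for x i
    by (simp add: Q_def matrix_vector_mult_def algebra_simps sum_subtractf)
  define d where "d j = (if \<mu> j = 1 then 0 else \<mu> j)" for j
  have "Q *v column j C = d j *s column j C" for j
  proof -
    define c where "c = column j C"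
    have c: "(\<Sum>k\<in>UNIV. of_real (P $ i $ k) * c $ k) = \<mu> j * c $ i" for i
      using arg_cong[OF eig[of j], of "\<lambda>v. v $ i"] by (simp add: matrix_vector_mult_def c_def)
    have Qc: "(Q *v c) $ i = \<mu> j * c $ i - (\<Sum>k\<in>UNIV. of_real (p $ k) * c $ k)" for i
      unfolding Qv c[symmetric] by (simp add: matrix_vector_mult_def)
    have "(Q *v c) $ i = d j * c $ i" for i
    proof (cases "\<mu> j = 1")
      case True
      \<comment> \<open>As \<open>P\<close> is real, the real and imaginary parts of
        \<open>c\<close> are harmonic separately, so \<open>const\<close> makes \<open>c\<close> a
        constant vector.\<close>
      have "P *v (\<chi> i. Re (c $ i)) = (\<chi> i. Re (c $ i))"
        using arg_cong[OF c, of Re] True by (simp add: vec_eq_iff matrix_vector_mult_def)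
      moreover have "P *v (\<chi> i. Im (c $ i)) = (\<chi> i. Im (c $ i))"
        using arg_cong[OF c, of Im] True by (simp add: vec_eq_iff matrix_vector_mult_def)
      ultimately have eq: "c $ k = c $ i" for i k
        using const[of "\<chi> i. Re (c $ i)" k i] const[of "\<chi> i. Im (c $ i)" k i]
        by (simp add: complex_eq_iff)
      have "(\<Sum>k\<in>UNIV. of_real (p $ k) * c $ k) = of_real (\<Sum>k\<in>UNIV. p $ k) * c $ i"
        unfolding of_real_sum sum_distrib_right by (intro sum.cong refl arg_cong2[where f = times] eq)
      then show ?thesis by (simp add: Qc p(2) d_def True)
    next
      case False
      \<comment> \<open>Evaluating \<open>p\<close> against \<open>P c\<close> in two ways, by
        stationarity and by the eigenvector equation, gives
        \<open>?s = \<mu> j * ?s\<close>.\<close>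
      let ?s = "\<Sum>k\<in>UNIV. of_real (p $ k) * c $ k"
      have "?s = (\<Sum>k\<in>UNIV. of_real (\<Sum>i\<in>UNIV. p $ i * P $ i $ k) * c $ k)"
        by (simp only: stat)
      also have "\<dots> = (\<Sum>k\<in>UNIV. \<Sum>i\<in>UNIV. of_real (p $ i) * (of_real (P $ i $ k) * c $ k))"
        by (simp add: sum_distrib_right mult.assoc)
      also have "\<dots> = (\<Sum>i\<in>UNIV. of_real (p $ i) * (\<Sum>k\<in>UNIV. of_real (P $ i $ k) * c $ k))"
        by (subst sum.swap) (simp add: sum_distrib_left)
      also have "\<dots> = \<mu> j * ?s"
        unfolding c by (simp add: sum_distrib_left mult_ac)
      finally have "?s = 0" using False by simp
      then show ?thesis by (simp add: Qc d_def False)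
    qed
    then show ?thesis by (simp add: vec_eq_iff flip: c_def)
  qed
  then have QC: "Q ** C = C ** diag_matrix d"
    by (simp add: matrix_mult_eq_mult_diag_matrix_iff)
  define x :: "complex^'n" where "x = (\<chi> i. of_real (f $ i))"
  have "(Q *v x) $ i = of_real ((P *v f - (p \<bullet> f) *s 1) $ i)" for i
    unfolding Qv by (simp add: x_def matrix_vector_mult_def inner_vec_def)
  then have "norm (P *v f - (p \<bullet> f) *s 1) = norm (Q *v x)"
    by (simp add: norm_vec_def del: vector_minus_component)
  also have "Q *v x = C *v (diag_matrix d *v (matrix_inv C *v x))"
    by (metis QC matrix_inv_mult(1)[OF inv] matrix_vector_mul_assoc matrix_vector_mul_lid)
  also have "norm \<dots> \<le> opnorm C * norm (diag_matrix d *v (matrix_inv C *v x))"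
    by (rule norm_matrix_vector_mult_le_opnorm)
  also have "\<dots> \<le> opnorm C * (r * (opnorm (matrix_inv C) * norm x))"
  proof (rule mult_left_mono)
    have "norm (diag_matrix d *v (matrix_inv C *v x)) \<le> r * norm (matrix_inv C *v x)"
      by (rule norm_diag_matrix_mult_vec_le) (use r in \<open>auto simp: d_def\<close>)
    also have "\<dots> \<le> r * (opnorm (matrix_inv C) * norm x)"
      by (intro mult_left_mono norm_matrix_vector_mult_le_opnorm r)
    finally show "norm (diag_matrix d *v (matrix_inv C *v x))
        \<le> r * (opnorm (matrix_inv C) * norm x)" .
    show "0 \<le> opnorm C" unfolding opnorm_def by (rule onorm_pos_le) simp
  qed
  also have "norm x = norm f" by (simp add: x_def norm_vec_def)
  finally show ?thesis by (simp add: cond_number_def mult_ac)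
qed

text \<open>Equality across single arcs propagates along directed paths. This shows that the
  eigenspace for 1 is one-dimensional, without Perron-Frobenius theory.\<close>

lemma strongly_connected_harmonic_const:
  fixes G :: "('n::finite, 'e) pre_digraph"
  assumes "fin_digraph G" and "strongly_connected G" and "verts G = UNIV"
    and rows: "\<And>i. (\<Sum>j\<in>UNIV. transition_matrix G $ i $ j) = 1"
    and "stationary_distribution (transition_matrix G) p"
    and "transition_matrix G *v f = f"
  shows "f $ i = f $ j"
proof -
  interpret fin_digraph G by fact
  have arc: "f $ u = f $ v" if "(u, v) \<in> arcs_ends G" for u v
  proof (rule harmonic_eq_on_arcs[OF _ rows assms(5,6)])
    have "out_arcs G u \<noteq> {}" using that by (auto simp: arcs_ends_def arc_to_ends_def)
    then have "out_degree G u > 0" by (simp add: out_degree_def card_gt_0_iff finite_out_arcs)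
    then show "transition_matrix G $ u $ v > 0" using that by (simp add: transition_matrix_def)
  qed (simp add: transition_matrix_def)
  have "i \<rightarrow>\<^sup>*\<^bsub>G\<^esub> j" using assms(2,3) by (simp add: strongly_connected_def)
  then show ?thesis by (induction rule: reachable_induct) (auto simp: arc)
qed

section \<open>From the mixing inequality to the ratio bound\<close>

text \<open>To be applied with \<open>x\<close>, \<open>y\<close>, \<open>s\<close> the sizes of
  \<open>X\<close>, \<open>Y\<close>, \<open>S\<close> and \<open>c\<close> the number of
  components. If \<open>s / c\<close> were below the bound \<open>T\<close>, monotonicity of
  \<open>t * (1 + t)\<close> would reduce the mixing inequality to a false polynomial inequality in
  \<open>\<sigma>\<close>.\<close>

lemma ratio_bound_of_mixing:
  fixes \<sigma> s c x y :: real
  assumes "\<sigma> > 0" and "s \<ge> 0" and "c > 0" and "c / 3 \<le> x" and "c / 3 \<le> y" and "c \<le> x + y"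
    and mix: "x * y \<le> \<sigma>\<^sup>2 * ((y + s) * (x + s))"
  shows "(1 / \<sigma> - 1 / (1 + \<sigma>) - 1) / 3 \<le> s / c"
proof (rule ccontr)
  define t where "t = s / c"
  define w where "w = \<sigma> * (1 + \<sigma>)"
  define T where "T = (1 - w) / (3 * w)"
  have "w > 0" using assms(1) by (simp add: w_def)
  have T: "(1 / \<sigma> - 1 / (1 + \<sigma>) - 1) / 3 = T"
  proof -
    have "1 / \<sigma> - 1 / (1 + \<sigma>) = 1 / w" using assms(1) by (simp add: w_def field_simps)
    then show ?thesis using \<open>w > 0\<close> by (simp add: T_def diff_divide_distrib)
  qed
  assume "\<not> ?thesis"
  then have "t < T" unfolding T t_def by simp
  have "t \<ge> 0" using assms by (simp add: t_def)
  \<comment> \<open>Since \<open>t\<close> is nonnegative, \<open>t < T\<close> forces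
    \<open>T\<close> to be positive. This yields the sign of \<open>1 - \<sigma>\<^sup>2\<close> by
    which an inequality is multiplied below.\<close>
  have "w < 1"
  proof (rule ccontr)
    assume "\<not> w < 1"
    then have "T \<le> 0" using \<open>w > 0\<close> by (simp add: T_def divide_nonpos_pos)
    then show False using \<open>t < T\<close> \<open>t \<ge> 0\<close> by simp
  qed
  moreover have "w = \<sigma> + \<sigma>\<^sup>2" by (simp add: w_def power2_eq_square algebra_simps)
  ultimately have s1: "0 \<le> 1 - \<sigma>\<^sup>2" using assms(1) by linarith
  \<comment> \<open>The average of the bounds \<open>c * y / 3\<close> and \<open>c * x / 3\<close>
    for \<open>x * y\<close>.\<close>
  have "c * (x + y) / 6 \<le> x * y"
  proof -
    have "0 \<le> (x - c / 3) * y" "0 \<le> (y - c / 3) * x" using assms by simp_all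
    then show ?thesis by (simp add: algebra_simps)
  qed
  then have "(c * (x + y) / 6) * (1 - \<sigma>\<^sup>2) \<le> (x * y) * (1 - \<sigma>\<^sup>2)"
    by (rule mult_right_mono[OF _ s1])
  also have "\<dots> \<le> \<sigma>\<^sup>2 * s * (x + y + s)" using mix by (simp add: algebra_simps)
  finally have "(c * (x + y)) * (1 - \<sigma>\<^sup>2) \<le> 6 * \<sigma>\<^sup>2 * s * (x + y + s)" by simp
  also have "s = t * c" using assms(3) by (simp add: t_def)
  also have "6 * \<sigma>\<^sup>2 * (t * c) * (x + y + t * c) \<le> 6 * \<sigma>\<^sup>2 * (t * c) * ((x + y) * (1 + t))"
  proof (rule mult_left_mono)
    have "t * c \<le> t * (x + y)" using assms(6) \<open>t \<ge> 0\<close> by (rule mult_left_mono)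
    then show "x + y + t * c \<le> (x + y) * (1 + t)" by (simp add: algebra_simps)
  qed (use \<open>t \<ge> 0\<close> assms in simp)
  finally have "(c * (x + y)) * (1 - \<sigma>\<^sup>2) \<le> (c * (x + y)) * (6 * \<sigma>\<^sup>2 * (t * (1 + t)))"
    by (simp add: mult_ac)
  moreover have "c * (x + y) > 0" using assms by simp
  ultimately have "1 - \<sigma>\<^sup>2 \<le> 6 * \<sigma>\<^sup>2 * (t * (1 + t))" by (simp only: mult_le_cancel_left_pos)
  also have "\<dots> < 6 * \<sigma>\<^sup>2 * (T * (1 + T))"
    using \<open>t < T\<close> \<open>t \<ge> 0\<close> assms(1) by (intro mult_strict_left_mono mult_strict_mono') auto
  \<comment> \<open>The factor \<open>9 * w\<^sup>2\<close> clears the denominators of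
    \<open>T * (1 + T)\<close>, as \<open>3 * w * T = 1 - w\<close>.\<close>
  finally have "9 * w\<^sup>2 * (1 - \<sigma>\<^sup>2) < 9 * w\<^sup>2 * (6 * \<sigma>\<^sup>2 * (T * (1 + T)))"
    using \<open>w > 0\<close> by simp
  also have "\<dots> = 6 * \<sigma>\<^sup>2 * ((3 * w * T) * (3 * w + 3 * w * T))"
    by (simp add: power2_eq_square algebra_simps)
  also have "3 * w * T = 1 - w" using \<open>w > 0\<close> by (simp add: T_def)
  also have "9 * w\<^sup>2 * (1 - \<sigma>\<^sup>2) = \<sigma>\<^sup>2 * (9 * (1 + \<sigma>)\<^sup>2 * (1 - \<sigma>\<^sup>2))"
    by (simp add: w_def power_mult_distrib)
  also have "6 * \<sigma>\<^sup>2 * ((1 - w) * (3 * w + (1 - w))) = \<sigma>\<^sup>2 * (6 * ((1 - w) * (1 + 2 * w)))"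
    by (simp add: algebra_simps)
  finally have "\<sigma>\<^sup>2 * (9 * (1 + \<sigma>)\<^sup>2 * (1 - \<sigma>\<^sup>2)) < \<sigma>\<^sup>2 * (6 * ((1 - w) * (1 + 2 * w)))" .
  then have "9 * (1 + \<sigma>)\<^sup>2 * (1 - \<sigma>\<^sup>2) < 6 * ((1 - w) * (1 + 2 * w))"
    using assms(1) by (simp only: mult_less_cancel_left_pos zero_less_power)
  moreover have "9 * (1 + \<sigma>)\<^sup>2 * (1 - \<sigma>\<^sup>2) - 6 * ((1 - w) * (1 + 2 * w))
      = 3 + 12 * \<sigma> + 6 * \<sigma>\<^sup>2 + 6 * \<sigma> ^ 3 + 3 * \<sigma> ^ 4"
    by (simp add: w_def power2_eq_square power3_eq_cube power4_eq_xxxx algebra_simps)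
  moreover have "0 < 3 + 12 * \<sigma> + 6 * \<sigma>\<^sup>2 + 6 * \<sigma> ^ 3 + 3 * \<sigma> ^ 4"
    using assms(1) by (simp add: add_pos_pos)
  ultimately show False by linarith
qed

section \<open>The toughness bound for an arbitrary separating set\<close>

theorem theorem4p1:
  fixes \<Gamma> :: "('n::finite, 'e) pre_digraph"
    and P :: "real^'n^'n"
    and Pc C :: "complex^'n^'n"
    and p :: "real^'n"
    and p_max p_min \<rho> :: real
  assumes "fin_digraph \<Gamma>" and "nomulti_digraph \<Gamma>" and "verts \<Gamma> = UNIV"
    and "strongly_connected \<Gamma>"
    and "P = transition_matrix \<Gamma>"
    and "Pc = map_matrix complex_of_real P"
    and "irreducible_matrix P" and "aperiodic_matrix P"
    and "diagonalizable_matrix Pc"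
    and "\<forall>j. norm (column j C) = 1 \<and> (\<exists>\<mu>. eigenvector_of Pc (column j C) \<mu>)"
    and "vec.independent (columns C)" and "vec.span (columns C) = UNIV"
    and "stationary_distribution P p"
    and "p_max = Max (range (\<lambda>i. p $ i))" and "p_min = Min (range (\<lambda>i. p $ i))"
    and "\<rho> = Max {cmod \<mu> | \<mu>. eigenvalue_of Pc \<mu> \<and> \<mu> \<noteq> 1}"
  shows "toughness \<Gamma> \<ge>
    ereal (1 / 3) *
      (ereal p_min / ereal (p_max * \<rho> * cond_number C)
       - ereal (1 / (1 + \<rho> * (opnorm C)\<^sup>2 * p_min / (cond_number C * p_max)))
       - 1)"
  unfolding toughness_def
proof (rule INF_greatest)
  interpret \<Gamma>: fin_digraph \<Gamma> by fact
  \<comment> \<open>With no separating set the infimum is infinite and nothing has to be shown. A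
    given \<open>S\<close> supplies two distinct vertices, and through mixing also an eigenvalue
    other than 1.\<close>
  fix S assume "S \<in> {S. S \<subseteq> verts \<Gamma> \<and> 2 \<le> card (pre_digraph.sccs (\<Gamma> \<restriction> (verts \<Gamma> - S)))}"
  define H where "H = \<Gamma> \<restriction> (verts \<Gamma> - S)"
  define c where "c = card (pre_digraph.sccs H)"
  have "2 \<le> c" using \<open>S \<in> _\<close> by (simp add: c_def H_def)
  interpret H: fin_digraph H
    unfolding H_def by (rule \<Gamma>.fin_digraph_subgraph, rule induced_imp_subgraph) auto
  have vH: "verts H = - S" by (auto simp: H_def assms(3))
  have arcs_H: "(u, v) \<in> arcs_ends H" if "(u, v) \<in> arcs_ends \<Gamma>" "u \<notin> S" "v \<notin> S" for u v
    using that assms(3) by (auto simp: H_def arcs_ends_def arc_to_ends_def induce_subgraph_def)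
  obtain X Y where XY: "X \<union> Y = - S" "X \<inter> Y = {}" "c div 2 \<le> card X" "c div 2 \<le> card Y"
      and one_way: "\<And>u v. u \<in> X \<Longrightarrow> v \<in> Y \<Longrightarrow> (u, v) \<notin> arcs_ends H"
    using H.ex_one_way_bipartition unfolding vH c_def by blast
  have noarc: "P $ u $ v = 0" if "u \<in> X" "v \<in> Y" for u v
    using arcs_H[of u v] one_way[OF that] that XY(1)
    by (auto simp: assms(5) transition_matrix_def)
  have ne: "X \<noteq> {}" "Y \<noteq> {}" using XY(3,4) \<open>2 \<le> c\<close> by auto
  have card_XY: "card X + card Y = card (- S)"
    using card_Un_disjoint[of X Y] XY(1,2) by simp
  have "c \<le> card (- S)" using H.card_sccs_le_card_verts by (simp add: vH c_def)

  have "- X = Y \<union> S" "- Y = X \<union> S" "Y \<inter> S = {}" "X \<inter> S = {}" using XY(1,2) by blast+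
  then have card_Compl: "card (- X) = card Y + card S" "card (- Y) = card X + card S"
    by (simp_all add: card_Un_disjoint)

  have "out_degree \<Gamma> i > 0" for i
  proof -
    obtain u v where "u \<in> X" "v \<in> Y" using ne by blast
    then have "u \<noteq> v" using XY(2) by blast
    then have "\<exists>j. i \<noteq> j" by metis
    then show ?thesis
      using \<Gamma>.out_degree_pos_if_strongly_connected[OF assms(4), of i] by (auto simp: assms(3))
  qed
  then have rows: "(\<Sum>j\<in>UNIV. P $ i $ j) = 1" for i
    unfolding assms(5) by (intro row_sum_transition_matrix assms(2))
  have const: "f $ i = f $ j" if "P *v f = f" for f i j
    using strongly_connected_harmonic_const[OF assms(1,4,3)] rows assms(13) that
    unfolding assms(5) by blast
  have inv: "invertible C"
    using assms(12) by (simp add: invertible_right_inverse matrix_right_invertible_span_columns)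
  obtain \<mu> where \<mu>: "\<And>j. eigenvector_of Pc (column j C) (\<mu> j)" using assms(10) by metis
  then have eig: "Pc *v column j C = \<mu> j *s column j C" for j by (simp add: eigenvector_of_def)
  \<comment> \<open>Stated for a general \<open>r\<close>, since \<open>\<rho>\<close> is a
    \<open>Max\<close> and can be used only once its set is known to be finite and nonempty.\<close>
  have deflation: "norm (P *v f - (p \<bullet> f) *s 1) \<le> r * cond_number C * norm f"
    if "0 \<le> r" "\<And>j. \<mu> j \<noteq> 1 \<Longrightarrow> cmod (\<mu> j) \<le> r" for r f
    by (rule norm_deflation_le[OF rows assms(13) const inv eig[unfolded assms(6)] that])

  have inv_ge: "1 \<le> opnorm (matrix_inv C)"
    using one_le_opnorm_matrix_inv[OF inv] assms(10) by blast
  have "opnorm C > 0"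
    using norm_column_le_opnorm[of _ C] assms(10) by (metis less_le_trans zero_less_one)
  define \<kappa> where "\<kappa> = cond_number C"
  have "opnorm C \<le> \<kappa>"
    using inv_ge \<open>opnorm C > 0\<close> by (simp add: \<kappa>_def cond_number_def)
  then have "\<kappa> > 0" using \<open>opnorm C > 0\<close> by simp

  have p: "p $ i > 0" for i using assms(13) by (simp add: stationary_distribution_def)
  have pmin: "p_min \<le> p $ i" and pmax: "p $ i \<le> p_max" for i by (auto simp: assms(14,15))
  have "p_min > 0" using p by (auto simp: assms(15))
  have "p_min \<le> p_max" using pmin pmax order_trans by blast
  then have "p_max > 0" using \<open>p_min > 0\<close> by simp
  have mixing: "p_min\<^sup>2 * (real (card X) * real (card Y))
      \<le> (r * \<kappa> * p_max)\<^sup>2 * (real (card (- X)) * real (card (- Y)))"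
    if "0 \<le> r" "\<And>j. \<mu> j \<noteq> 1 \<Longrightarrow> cmod (\<mu> j) \<le> r" for r
    by (rule one_way_mixing[OF rows assms(13) pmin \<open>p_min > 0\<close> pmax _ _ ne noarc])
      (use deflation[OF that] that(1) \<open>\<kappa> > 0\<close> in \<open>simp_all add: \<kappa>_def\<close>)
  \<comment> \<open>With \<open>r = 0\<close> mixing would make a positive product nonpositive.
    Taking \<open>r\<close> as 0 yields some \<open>\<mu> j \<noteq> 1\<close>; taking
    \<open>r\<close> as \<open>\<rho>\<close> then yields \<open>\<rho> > 0\<close>.\<close>
  have mixing_pos: "r \<noteq> 0" if "0 \<le> r" "\<And>j. \<mu> j \<noteq> 1 \<Longrightarrow> cmod (\<mu> j) \<le> r" for r
  proof
    assume "r = 0"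
    then have "p_min\<^sup>2 * (real (card X) * real (card Y)) \<le> 0" using mixing[OF that] by simp
    moreover have "p_min\<^sup>2 * (real (card X) * real (card Y)) > 0"
      using \<open>p_min > 0\<close> ne by (simp add: card_gt_0_iff)
    ultimately show False by simp
  qed

  let ?A = "{cmod \<mu> | \<mu>. eigenvalue_of Pc \<mu> \<and> \<mu> \<noteq> 1}"
  have "?A \<subseteq> cmod ` range \<mu>" using eigenvalue_of_diagonalized[OF inv eig] by blast
  then have "finite ?A" by (rule finite_subset) simp
  then have \<rho>_ge: "cmod (\<mu> j) \<le> \<rho>" if "\<mu> j \<noteq> 1" for j
    unfolding assms(16) using that \<mu> by (intro Max_ge) (auto simp: eigenvalue_of_def)
  obtain j where "\<mu> j \<noteq> 1" using mixing_pos[of 0] by auto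
  then have "\<rho> \<ge> 0" using \<rho>_ge[of j] norm_ge_zero order_trans by blast
  then have "\<rho> > 0" using mixing_pos[of \<rho>] \<rho>_ge by fastforce

  define \<sigma> where "\<sigma> = \<rho> * \<kappa> * p_max / p_min"
  have "\<sigma> > 0" using \<open>\<rho> > 0\<close> \<open>\<kappa> > 0\<close> \<open>p_max > 0\<close> \<open>p_min > 0\<close> by (simp add: \<sigma>_def)
  have "real (card X) * real (card Y)
      \<le> \<sigma>\<^sup>2 * ((real (card Y) + real (card S)) * (real (card X) + real (card S)))"
    using mixing[OF \<open>\<rho> \<ge> 0\<close> \<rho>_ge] \<open>p_min > 0\<close>
    by (simp add: \<sigma>_def card_Compl power_divide pos_le_divide_eq mult.commute[of _ "p_min\<^sup>2"])
  \<comment> \<open>Halving loses the most at \<open>c = 3\<close>, where one part may have a single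
    vertex; this is the source of the fraction 1/3.\<close>
  moreover have "real c / 3 \<le> real (c div 2)"
  proof -
    have "c \<le> 3 * (c div 2)" using \<open>2 \<le> c\<close> by presburger
    then have "real c \<le> real (3 * (c div 2))" by (rule of_nat_mono)
    then show ?thesis by simp
  qed
  then have "real c / 3 \<le> real (card X)" "real c / 3 \<le> real (card Y)"
    using XY(3,4) by (meson of_nat_mono order_trans)+
  moreover have "real c \<le> real (card X) + real (card Y)"
    using \<open>c \<le> card (- S)\<close> card_XY by linarith
  ultimately have main: "(1 / \<sigma> - 1 / (1 + \<sigma>) - 1) / 3 \<le> real (card S) / real c"
    using \<open>2 \<le> c\<close> \<open>\<sigma> > 0\<close> by (intro ratio_bound_of_mixing) auto

  define \<tau> where "\<tau> = \<rho> * (opnorm C)\<^sup>2 * p_min / (\<kappa> * p_max)"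
  have "\<tau> \<ge> 0" using \<open>\<rho> > 0\<close> \<open>\<kappa> > 0\<close> \<open>p_max > 0\<close> \<open>p_min > 0\<close> by (simp add: \<tau>_def)
  \<comment> \<open>The stated bound has \<open>\<tau>\<close> where \<open>main\<close> has
    \<open>\<sigma>\<close>; the smaller denominator subtracts more and so weakens it.\<close>
  have "\<tau> \<le> \<sigma>"
  proof -
    have "(opnorm C * p_min)\<^sup>2 \<le> (\<kappa> * p_max)\<^sup>2"
      using \<open>opnorm C \<le> \<kappa>\<close> \<open>p_min \<le> p_max\<close> \<open>opnorm C > 0\<close> \<open>p_min > 0\<close>
      by (intro power_mono mult_mono) auto
    then have "\<rho> * (opnorm C * p_min)\<^sup>2 \<le> \<rho> * (\<kappa> * p_max)\<^sup>2"
      using \<open>\<rho> \<ge> 0\<close> by (rule mult_left_mono)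
    then show ?thesis
      using \<open>\<kappa> > 0\<close> \<open>p_max > 0\<close> \<open>p_min > 0\<close>
      by (simp add: \<tau>_def \<sigma>_def divide_simps power2_eq_square mult_ac)
  qed
  then have "1 / (1 + \<sigma>) \<le> 1 / (1 + \<tau>)" using \<open>\<tau> \<ge> 0\<close> by (simp add: frac_le)
  then have "1 / 3 * (1 / \<sigma> - 1 / (1 + \<tau>) - 1) \<le> real (card S) / real c" using main by simp
  moreover have "1 / \<sigma> = p_min / (p_max * \<rho> * \<kappa>)" by (simp add: \<sigma>_def mult_ac)
  \<comment> \<open>A nonzero denominator makes the extended real quotient agree with the real
    one.\<close>
  moreover have "p_max * \<rho> * \<kappa> \<noteq> 0" using \<open>\<rho> > 0\<close> \<open>\<kappa> > 0\<close> \<open>p_max > 0\<close> by simp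
  ultimately show "ereal (1 / 3) *
      (ereal p_min / ereal (p_max * \<rho> * cond_number C)
       - ereal (1 / (1 + \<rho> * (opnorm C)\<^sup>2 * p_min / (cond_number C * p_max)))
       - 1)
    \<le> ereal (real (card S) / real (card (pre_digraph.sccs (\<Gamma> \<restriction> (verts \<Gamma> - S)))))"
    unfolding \<kappa>_def[symmetric] \<tau>_def[symmetric] H_def[symmetric] c_def[symmetric]
    by (simp add: one_ereal_def)
qed

end
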